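(* Let $K$ be a finite Eulerian poset with rank function $\rho$, and let $P\in \mathrm{Or}(K)$ be a projection. Then $\mathrm{Im}(P)$, as an induced subposet of $K$, is graded with rank function (the restriction of) $\rho$.
   Context: A finite poset $K$ is graded if it has a minimum $\hat 0$, a maximum $\hat 1$ and a rank function $\rho:K\to\mathbb N$ (so $\rho(y)=\rho(x)+1$ whenever $y$ covers $x$). It is Eulerian if it is graded and its Möbius function satisfies $\mu_K(x,y)=(-1)^{\rho(y)-\rho(x)}$ for all $x\leqslant y$. $\mathrm{Or}(K)$ is the monoid (under composition) of functions $f:K\to K$ that are order preserving and regressive ($f(x)\leqslant x$ for all $x$). For $f:K\to K$ and $y\in K$, $f_y:=\{x\in K: f(x)=y\}$ and $\mathrm{Im}(f)$ is the image. An idempotent $P\in\mathrm{Or}(K)$ is a projection if for all $x,y\in\mathrm{Im}(P)$ with $x\leqslant y$ the set $[x,y]\cap P_x$ is an interval $[a,b]=\{z: a\leqslant z\leqslant b\}$ of $K$. *)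

theory Defs
  imports Main "HOL-Library.FuncSet"
begin

text \<open>
  A finite poset is a finite set \<^term>\<open>K\<close> of elements of a type of class \<^class>\<open>order\<close>, with the
  induced order; induced subposets are then just subsets of \<^term>\<open>K\<close>. All notions below depend
  only on the order between elements of \<^term>\<open>K\<close> and on the values of functions on \<^term>\<open>K\<close>.
\<close>

definition interval_in :: "'a::order set \<Rightarrow> 'a \<Rightarrow> 'a \<Rightarrow> 'a set" where
  "interval_in K x y = {z \<in> K. x \<le> z \<and> z \<le> y}"

definition covers_in :: "'a::order set \<Rightarrow> 'a \<Rightarrow> 'a \<Rightarrow> bool" where
  "covers_in K x y \<longleftrightarrow> x \<in> K \<and> y \<in> K \<and> x < y \<and> \<not> (\<exists>z\<in>K. x < z \<and> z < y)"

text \<open>The rank function is not required to vanish at the minimum.\<close>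

definition graded_poset :: "'a::order set \<Rightarrow> ('a \<Rightarrow> nat) \<Rightarrow> bool" where
  "graded_poset K \<rho> \<longleftrightarrow>
     finite K \<and>
     (\<exists>b\<in>K. \<forall>x\<in>K. b \<le> x) \<and>
     (\<exists>t\<in>K. \<forall>x\<in>K. x \<le> t) \<and>
     (\<forall>x y. covers_in K x y \<longrightarrow> \<rho> y = \<rho> x + 1)"

text \<open>
  The Moebius function of a finite poset, by the usual recursion. It is extended by 0 to
  pairs of elements outside \<^term>\<open>K\<close> and, to make the recursion well-founded, to infinite \<^term>\<open>K\<close>.
\<close>

function moebius :: "'a::order set \<Rightarrow> 'a \<Rightarrow> 'a \<Rightarrow> int" where
  "moebius K x y =
     (if finite K \<and> x \<in> K \<and> y \<in> K then
        if x = y then 1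
        else if x < y then - (\<Sum>z\<in>{z \<in> K. x \<le> z \<and> z < y}. moebius K x z)
        else 0
      else 0)"
  by pat_completeness auto
termination
proof (relation "measure (\<lambda>(K, x, y). card {w \<in> K. w < y})", goal_cases)
  case 1
  show ?case by simp
next
  case (2 K x y z)
  then have "{w \<in> K. w < z} \<subset> {w \<in> K. w < y}"
    by auto
  with 2 show ?case
    by (auto intro!: psubset_card_mono)
qed

declare moebius.simps [simp del]

text \<open>
  In a finite graded poset \<open>x \<le> y\<close> implies \<open>\<rho> x \<le> \<rho> y\<close>, so the subtraction of
  natural numbers in the exponent is not truncated.
\<close>

definition eulerian_poset :: "'a::order set \<Rightarrow> ('a \<Rightarrow> nat) \<Rightarrow> bool" where
  "eulerian_poset K \<rho> \<longleftrightarrow>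
     graded_poset K \<rho> \<and>
     (\<forall>x\<in>K. \<forall>y\<in>K. x \<le> y \<longrightarrow> moebius K x y = (-1) ^ (\<rho> y - \<rho> x))"

definition Or :: "'a::order set \<Rightarrow> ('a \<Rightarrow> 'a) set" where
  "Or K = {f \<in> K \<rightarrow> K. mono_on K f \<and> (\<forall>x\<in>K. f x \<le> x)}"

definition fiber_in :: "'a set \<Rightarrow> ('a \<Rightarrow> 'a) \<Rightarrow> 'a \<Rightarrow> 'a set" where
  "fiber_in K f y = {x \<in> K. f x = y}"

definition is_projection :: "'a::order set \<Rightarrow> ('a \<Rightarrow> 'a) \<Rightarrow> bool" where
  "is_projection K P \<longleftrightarrow>
     P \<in> Or K \<and>
     (\<forall>x\<in>K. P (P x) = P x) \<and>
     (\<forall>x \<in> P ` K. \<forall>y \<in> P ` K. x \<le> y \<longrightarrow>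
        (\<exists>a\<in>K. \<exists>b\<in>K. interval_in K x y \<inter> fiber_in K P x = interval_in K a b))"

end

(* If y covers x in the image of P, then P maps every z with x <= z < y to x, so these z form
   an interval [x,b].  Unless b = x, in which case y covers x in K, the values mu(x,z) over
   [x,b] sum to 0, so mu(x,y) = 0, contradicting mu(x,y) = +-1. *)
theory Submission
  imports Defs
begin

lemma moebius_less:
  assumes "finite K" "x \<in> K" "y \<in> K" "x < y"
  shows "moebius K x y = - (\<Sum>z\<in>{z \<in> K. x \<le> z \<and> z < y}. moebius K x z)"
  using assms by (subst moebius.simps) auto

text \<open>Splitting off the top element \<open>y\<close> leaves exactly the sum that the recursion
  negates to define \<open>moebius K x y\<close>.\<close>

lemma sum_moebius_interval:
  assumes "finite K" "x \<in> K" "y \<in> K" "x < y"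
  shows "(\<Sum>z\<in>interval_in K x y. moebius K x z) = 0"
proof -
  have "interval_in K x y = insert y {z \<in> K. x \<le> z \<and> z < y}"
    using assms by (auto simp: interval_in_def)
  then show ?thesis
    using assms moebius_less[OF assms] by simp
qed

text \<open>The recursion for \<open>moebius K x y\<close> sums over a closed interval [x,b], where
  the total vanishes because \<open>x < b\<close>. For \<open>b = x\<close> the sum would be the
  single term 1.\<close>

lemma moebius_unique_coatom:
  assumes "finite K" "x \<in> K" "y \<in> K" "b \<in> K" "x < b" "x < y"
    and "{z \<in> K. x \<le> z \<and> z < y} = interval_in K x b"
  shows "moebius K x y = 0"
  using assms by (simp add: moebius_less sum_moebius_interval)

lemma projection_covers:
  assumes eul: "eulerian_poset K \<rho>" and proj: "is_projection K P"
    and cov: "covers_in (P ` K) x y"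
  shows "covers_in K x y"
proof -
  \<comment> \<open>Powers of -1 are nonzero; this is what the contradiction rests on.\<close>
  have fin: "finite K" and mu: "\<And>u v. u \<in> K \<Longrightarrow> v \<in> K \<Longrightarrow> u \<le> v \<Longrightarrow> moebius K u v \<noteq> 0"
    using eul by (auto simp: eulerian_poset_def graded_poset_def)
  have PK: "\<And>u. u \<in> K \<Longrightarrow> P u \<in> K" and Ple: "\<And>u. u \<in> K \<Longrightarrow> P u \<le> u"
    and Pmono: "\<And>u v. u \<in> K \<Longrightarrow> v \<in> K \<Longrightarrow> u \<le> v \<Longrightarrow> P u \<le> P v"
    and idem: "\<And>u. u \<in> K \<Longrightarrow> P (P u) = P u"
    using proj by (auto simp: is_projection_def Or_def dest: mono_onD)
  have xy: "x \<in> P ` K" "y \<in> P ` K" "x < y"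
    and nb: "\<And>z. z \<in> P ` K \<Longrightarrow> x < z \<Longrightarrow> \<not> z < y"
    using cov by (auto simp: covers_in_def)
  have K: "x \<in> K" "y \<in> K" and fp: "P x = x" "P y = y"
    using xy PK idem by auto
  \<comment> \<open>Here x = P x \<le> P z \<le> z < y, and \<open>P z\<close> lies in the image, so
    the cover forces \<open>P z = x\<close>.\<close>
  have fib: "P z = x" if z: "z \<in> K" "x \<le> z" "z < y" for z
  proof -
    have "x \<le> P z" "P z < y"
      using Pmono[of x z] Ple[of z] z K fp by auto
    moreover have "\<not> x < P z"
      using nb[of "P z"] \<open>P z < y\<close> z(1) by blast
    ultimately show ?thesis
      by (simp add: order_less_le)
  qed
  \<comment> \<open>The fiber over \<open>x\<close> omits \<open>y\<close>, since P y = y \<noteq>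
    x. What remains is the index set of the Moebius recursion at \<open>y\<close>.\<close>
  have half_open: "interval_in K x y \<inter> fiber_in K P x = {z \<in> K. x \<le> z \<and> z < y}"
  proof (intro equalityI subsetI)
    fix z assume "z \<in> interval_in K x y \<inter> fiber_in K P x"
    then have "z \<in> K" "x \<le> z" "z \<le> y" "P z = x"
      by (simp_all add: interval_in_def fiber_in_def)
    moreover have "z \<noteq> y"
      using fp(2) xy(3) \<open>P z = x\<close> by auto
    ultimately show "z \<in> {z \<in> K. x \<le> z \<and> z < y}"
      by (simp add: order_less_le)
  next
    fix z assume "z \<in> {z \<in> K. x \<le> z \<and> z < y}"
    then show "z \<in> interval_in K x y \<inter> fiber_in K P x"
      using fib[of z] by (simp add: interval_in_def fiber_in_def less_imp_le)
  qed
  have "\<exists>a\<in>K. \<exists>b\<in>K. interval_in K x y \<inter> fiber_in K P x = interval_in K a b"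
    using proj xy(1,2) less_imp_le[OF xy(3)] unfolding is_projection_def by blast
  then obtain a b where ab: "a \<in> K" "b \<in> K" "{z \<in> K. x \<le> z \<and> z < y} = interval_in K a b"
    unfolding half_open by blast
  \<comment> \<open>Since \<open>x\<close> is in the half-open set, [a,b] is nonempty and contains
    its own minimum \<open>a\<close>. All members are at least \<open>x\<close>, so
    \<open>a = x\<close>.\<close>
  have "x \<in> interval_in K a b"
    using K xy ab(3) by auto
  then have ax: "a \<le> x" "x \<le> b"
    by (auto simp: interval_in_def)
  then have "a \<in> interval_in K a b"
    using ab by (auto simp: interval_in_def)
  then have "x \<le> a"
    using ab(3) by blast
  with ax have "a = x"
    by simp
  have "\<not> x < b"
    using moebius_unique_coatom[OF fin K ab(2) _ xy(3)] ab(3) \<open>a = x\<close>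
      mu[OF K less_imp_le[OF xy(3)]] by blast
  then have "b = x"
    using ax by (simp add: order_less_le)
  \<comment> \<open>With \<open>a = b = x\<close> the half-open set is [x,x], leaving nothing
    strictly between \<open>x\<close> and \<open>y\<close>.\<close>
  have "\<not> (x < z \<and> z < y)" if "z \<in> K" for z
  proof
    assume "x < z \<and> z < y"
    then have "z \<in> interval_in K x x"
      using that ab(3) \<open>a = x\<close> \<open>b = x\<close> less_imp_le by blast
    with \<open>x < z \<and> z < y\<close> show False
      by (auto simp: interval_in_def)
  qed
  then show ?thesis
    using K xy(3) by (simp add: covers_in_def)
qed

theorem theorem4p11:
  fixes K :: "'a::order set" and \<rho> :: "'a \<Rightarrow> nat" and P :: "'a \<Rightarrow> 'a"
  assumes "eulerian_poset K \<rho>"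
    and "is_projection K P"
  shows "graded_poset (P ` K) \<rho>"
proof -
  have graded: "graded_poset K \<rho>"
    using assms(1) by (simp add: eulerian_poset_def)
  then obtain b t where bt: "b \<in> K" "t \<in> K" "\<forall>x\<in>K. b \<le> x" "\<forall>x\<in>K. x \<le> t"
    by (auto simp: graded_poset_def)
  have "mono_on K P"
    using assms(2) by (simp add: is_projection_def Or_def)
  \<comment> \<open>Monotonicity carries the extremes of \<open>K\<close> to extremes of the
    image.\<close>
  then have "\<forall>x\<in>P ` K. P b \<le> x" "\<forall>x\<in>P ` K. x \<le> P t"
    using bt by (auto dest: mono_onD)
  \<comment> \<open>Covers in the image are covers in \<open>K\<close>, where the rank already rises
    by one.\<close>
  moreover have "\<rho> y = \<rho> x + 1" if "covers_in (P ` K) x y" for x y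
    using graded projection_covers[OF assms that] by (simp add: graded_poset_def)
  moreover have "finite (P ` K)"
    using graded by (simp add: graded_poset_def)
  ultimately show ?thesis
    unfolding graded_poset_def using bt(1,2) by (meson imageI)
qed

end
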